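(* Let $E=\{(k2^m,(k+1)2^m):k,m\in\mathbb{Z}\}$ and, for $(p,q)\in E$, let $Q_{(p,q)}=\mathrm{unif}(p,q)$. (a) The set $\mathrm{Mix}\{Q_{(p,q)}:(p,q)\in E\}$ has no extreme elements. (b) Let $\mu$ be a probability measure on the Borel subsets of $\mathbb{R}$. If $\mu$ is absolutely continuous with a density that is Riemann integrable on all compact intervals, then $\mu$ is an element of $\mathrm{Mix}\{Q_{(p,q)}:(p,q)\in E\}$. (c) There exists a probability measure on the Borel subsets of $\mathbb{R}$ that is absolutely continuous and that is not an element of $\mathrm{Mix}\{Q_{(p,q)}:(p,q)\in E\}$.
   Context: $\mathrm{unif}(p,q)$ is the uniform distribution on the interval $(p,q)$, regarded as a probability measure on the Borel subsets of $\mathbb{R}$. Absolute continuity and densities refer to Lebesgue measure. For a countable family $\{Q_i:i\in E\}$ of probability measures, $\mathrm{Mix}\{Q_i:i\in E\}$ is the set of all probability measures of the form $\sum_{i\in E}p_iQ_i$ with $p_i\ge0$ and $\sum_{i\in E}p_i=1$. An extreme element of a convex set $M$ of probability measures is a $\mu\in M$ such that $\mu=\alpha\mu_1+(1-\alpha)\mu_2$ with $\mu_1,\mu_2\in M$ and $0<\alpha<1$ implies $\mu_1=\mu_2=\mu$. *)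

theory Defs
  imports "HOL-Probability.Probability"
begin

definition unif :: "real \<Rightarrow> real \<Rightarrow> real measure" where
  "unif p q = uniform_measure lborel {p<..<q}"

text \<open>The interval \<open>(p, q)\<close> is represented by its pair of endpoints.\<close>

definition dyadic_intervals :: "(real \<times> real) set" where
  "dyadic_intervals =
     {(of_int k * 2 powi m, (of_int k + 1) * 2 powi m) | (k :: int) (m :: int). True}"

text \<open>The identity \<open>\<mu> = (\<Sum>i\<in>E. w i * Q i)\<close> between measures is stated setwise, on all Borel sets.\<close>

definition Mix :: "'i set \<Rightarrow> ('i \<Rightarrow> real measure) \<Rightarrow> real measure set" where
  "Mix E Q = {\<mu>. prob_space \<mu> \<and> sets \<mu> = sets borel \<and>
     (\<exists>w :: 'i \<Rightarrow> real. (\<forall>i\<in>E. 0 \<le> w i) \<and> (w has_sum 1) E \<and>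
        (\<forall>A\<in>sets borel. ((\<lambda>i. w i * measure (Q i) A) has_sum measure \<mu> A) E))}"

text \<open>Intended for sets \<open>M\<close> of probability measures that all live on the same
  \<open>\<sigma>\<close>-algebra; for these the setwise identity expresses
  \<open>\<mu> = \<alpha> * \<mu>1 + (1 - \<alpha>) * \<mu>2\<close>.\<close>

definition extreme_element :: "'a measure set \<Rightarrow> 'a measure \<Rightarrow> bool" where
  "extreme_element M \<mu> \<longleftrightarrow> \<mu> \<in> M \<and>
     (\<forall>\<mu>1\<in>M. \<forall>\<mu>2\<in>M. \<forall>\<alpha>::real. 0 < \<alpha> \<and> \<alpha> < 1 \<and>
        (\<forall>A\<in>sets \<mu>. measure \<mu> A = \<alpha> * measure \<mu>1 A + (1 - \<alpha>) * measure \<mu>2 A)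
        \<longrightarrow> \<mu>1 = \<mu> \<and> \<mu>2 = \<mu>)"

text \<open>The library's \<open>integrable_on\<close> is Henstock--Kurzweil integrability, where the mesh
  may depend on the tag and which is strictly weaker. Here the mesh bound \<open>d\<close> is uniform.\<close>

definition riemann_integrable_on :: "(real \<Rightarrow> real) \<Rightarrow> real set \<Rightarrow> bool"
    (infix "riemann'_integrable'_on" 46) where
  "f riemann_integrable_on S \<longleftrightarrow>
     (\<exists>I. \<forall>e>0. \<exists>d>0. \<forall>D. D tagged_division_of S \<and> (\<forall>(x, K)\<in>D. diameter K < d) \<longrightarrow>
        \<bar>(\<Sum>(x, K)\<in>D. measure lborel K * f x) - I\<bar> < e)"

definition lebesgue_density :: "real measure \<Rightarrow> (real \<Rightarrow> real) \<Rightarrow> bool" where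
  "lebesgue_density \<mu> f \<longleftrightarrow> f \<in> borel_measurable lborel \<and> (AE x in lborel. 0 \<le> f x) \<and>
     \<mu> = density lborel (\<lambda>x. ennreal (f x))"

end

theory Submission
  imports Defs
begin

text \<open>
  \<^emph>\<open>No extreme elements.\<close> Some component of a mixture has positive weight, and every component is
  the average of the uniform distributions on the two halves of its interval, which are components
  again. Moving all its weight to the left half, or all of it to the right half, gives two
  different mixtures whose average is the original one
  (\<open>has_sum_move_weight\<close>, \<open>not_extreme_if_components_split\<close>).

  \<^emph>\<open>Riemann integrable densities.\<close> Let \<open>g\<^sub>n\<close> be the step function whose value on each dyadic
  cell of length \<open>2 ^ - n\<close> is the essential infimum of the density \<open>f\<close> there. The \<open>g\<^sub>n\<close> increase and
  stay below \<open>f\<close> almost everywhere. Each cell contains a point at which \<open>f\<close> is nearly its essential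
  infimum, so on \<open>[k, k + 1]\<close> the integrals of the \<open>g\<^sub>n\<close> are nearly Riemann sums of \<open>f\<close>, and they converge
  to the integral of \<open>f\<close>. Therefore \<open>g\<^sub>n\<close> tends to \<open>f\<close> almost everywhere (\<open>AE_SUP_cell_essinf\<close>), and
  \<open>f\<close> is the sum of \<open>g\<^sub>0\<close> and the increments \<open>g\<^sub>n\<^sub>+\<^sub>1 - g\<^sub>n\<close>, which are nonnegative and constant on dyadic
  cells: a mixture of uniform densities (\<open>emeasure_density_cell_increments\<close>). Intervals longer
  than 1 receive weight 0. Essential infima serve better than infima here because \<open>f\<close> is only
  almost everywhere nonnegative, and they do not see a change of \<open>f\<close> on a null set.

  \<^emph>\<open>An absolutely continuous measure that is not a mixture.\<close> A mixture gives positive mass to every open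
  set that meets an interval of positive weight. So it suffices to take the uniform distribution
  on a set of positive measure whose complement contains an open dense set
  (\<open>ex_absolutely_continuous_not_Mix\<close>).
\<close>

section \<open>Countable mixtures of probability measures\<close>

text \<open>Mixtures are built with integrals over a counting measure, where Fubini and reindexing are
  free of summability conditions; this lemma translates the result back into sums of reals.\<close>

lemma has_sum_iff_nn_integral_count_space:
  fixes f :: "'a \<Rightarrow> real"
  assumes nonneg: "\<And>x. x \<in> A \<Longrightarrow> 0 \<le> f x" and r: "0 \<le> r"
  shows "(f has_sum r) A \<longleftrightarrow> (\<integral>\<^sup>+x. ennreal (f x) \<partial>count_space A) = ennreal r"
proof -
  have AE: "AE x in count_space A. 0 \<le> f x"
    using nonneg by (simp add: AE_count_space)
  have abs: "f summable_on A \<longleftrightarrow> integrable (count_space A) f"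
    unfolding summable_on_iff_abs_summable_on_real[of f] abs_summable_equivalent
      Infinite_Set_Sum.abs_summable_on_def ..
  have sum: "integral\<^sup>L (count_space A) f = infsum f A" if "integrable (count_space A) f"
    using infsetsum_infsum[of f A] that
    by (simp add: Infinite_Set_Sum.abs_summable_on_def infsetsum_def)
  show ?thesis
  proof
    assume *: "(f has_sum r) A"
    then have int: "integrable (count_space A) f"
      using abs summable_on_def by blast
    show "(\<integral>\<^sup>+x. ennreal (f x) \<partial>count_space A) = ennreal r"
      using nn_integral_eq_integral[OF int AE] sum[OF int] infsumI[OF *] by simp
  next
    assume *: "(\<integral>\<^sup>+x. ennreal (f x) \<partial>count_space A) = ennreal r"
    have int: "integrable (count_space A) f"
      by (rule integrableI_nn_integral_finite[OF _ AE *]) simp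
    have "ennreal (infsum f A) = ennreal r"
      using nn_integral_eq_integral[OF int AE] sum[OF int] * by simp
    moreover have "0 \<le> infsum f A" using nonneg by (rule infsum_nonneg)
    ultimately have "infsum f A = r" using r by simp
    then show "(f has_sum r) A"
      using has_sum_infsum[of f A] abs int by simp
  qed
qed

lemma MixI_nn_integral:
  assumes \<mu>: "prob_space \<mu>" "sets \<mu> = sets borel"
    and Q: "\<And>i. i \<in> E \<Longrightarrow> prob_space (Q i)" "\<And>i. i \<in> E \<Longrightarrow> sets (Q i) = sets borel"
    and w: "\<And>i. i \<in> E \<Longrightarrow> 0 \<le> w i"
    and mix: "\<And>A. A \<in> sets borel \<Longrightarrow>
      emeasure \<mu> A = (\<integral>\<^sup>+i. ennreal (w i) * emeasure (Q i) A \<partial>count_space E)"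
  shows "\<mu> \<in> Mix E Q"
    and "A \<in> sets borel \<Longrightarrow> ((\<lambda>i. w i * measure (Q i) A) has_sum measure \<mu> A) E"
proof -
  interpret prob_space \<mu> by (rule \<mu>)
  have sum: "((\<lambda>i. w i * measure (Q i) A) has_sum measure \<mu> A) E" if A: "A \<in> sets borel" for A
  proof (subst has_sum_iff_nn_integral_count_space)
    have "(\<integral>\<^sup>+i. ennreal (w i * measure (Q i) A) \<partial>count_space E)
      = (\<integral>\<^sup>+i. ennreal (w i) * emeasure (Q i) A \<partial>count_space E)"
    proof (intro nn_integral_cong)
      fix i assume "i \<in> space (count_space E)"
      then have i: "i \<in> E" by simp
      interpret Q: prob_space "Q i" by (rule Q(1)[OF i])
      show "ennreal (w i * measure (Q i) A) = ennreal (w i) * emeasure (Q i) A"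
        by (simp add: Q.emeasure_eq_measure ennreal_mult w[OF i])
    qed
    then show "(\<integral>\<^sup>+i. ennreal (w i * measure (Q i) A) \<partial>count_space E) = ennreal (measure \<mu> A)"
      using mix[OF A] by (simp add: emeasure_eq_measure)
  qed (use w in auto)
  then show "A \<in> sets borel \<Longrightarrow> ((\<lambda>i. w i * measure (Q i) A) has_sum measure \<mu> A) E" .
  have sp: "space \<mu> = UNIV" using sets_eq_imp_space_eq[OF \<mu>(2)] by simp
  have "measure (Q i) UNIV = 1" if "i \<in> E" for i
    using prob_space.prob_space[OF Q(1)[OF that]] sets_eq_imp_space_eq[OF Q(2)[OF that]] by simp
  then have "((\<lambda>i. w i * measure (Q i) UNIV) has_sum 1) E \<longleftrightarrow> (w has_sum 1) E"
    by (intro has_sum_cong) simp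
  then have "(w has_sum 1) E"
    using sum[of UNIV] prob_space sp by simp
  then show "\<mu> \<in> Mix E Q"
    unfolding Mix_def using \<mu> w sum by blast
qed

text \<open>The weights are the mass function of a random index, and the mixture is the distribution
  obtained by drawing an index and then a point from the corresponding component.\<close>

lemma ex_mixture:
  assumes Q: "\<And>i. i \<in> E \<Longrightarrow> prob_space (Q i)" "\<And>i. i \<in> E \<Longrightarrow> sets (Q i) = sets borel"
    and w: "\<And>i. i \<in> E \<Longrightarrow> 0 \<le> w i" "(w has_sum 1) E"
  obtains \<nu> where "\<nu> \<in> Mix E Q"
    "\<And>A. A \<in> sets borel \<Longrightarrow> ((\<lambda>i. w i * measure (Q i) A) has_sum measure \<nu> A) E"
proof -
  define w' where "w' i = (if i \<in> E then w i else 0)" for i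
  \<comment> \<open>Outside \<open>E\<close> the kernel needs some probability measure as value; its weight there is 0.\<close>
  define Q' where "Q' i = (if i \<in> E then Q i else return borel 0)" for i
  have pmf: "pmf (embed_pmf w') i = w' i" for i
  proof (rule pmf_embed_pmf)
    show "0 \<le> w' i" for i using w(1) by (simp add: w'_def)
    have "(\<integral>\<^sup>+i. ennreal (w' i) \<partial>count_space UNIV) = (\<integral>\<^sup>+i. ennreal (w i) \<partial>count_space E)"
      by (subst nn_integral_count_space_indicator)
         (auto simp: w'_def intro!: nn_integral_cong split: split_indicator)
    also have "\<dots> = 1"
      using has_sum_iff_nn_integral_count_space[of E w 1] w by simp
    finally show "(\<integral>\<^sup>+i. ennreal (w' i) \<partial>count_space UNIV) = 1" .
  qed
  define \<nu> where "\<nu> = measure_pmf (embed_pmf w') \<bind> Q'"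
  have Q'_prob: "prob_space (Q' i)" and Q'_sets: "sets (Q' i) = sets borel" for i
    using Q by (simp_all add: Q'_def prob_space_return)
  have Q': "Q' \<in> measurable (measure_pmf (embed_pmf w')) (prob_algebra borel)"
    by (simp add: space_prob_algebra Q'_prob Q'_sets)
  have M: "measure_pmf (embed_pmf w') \<in> space (prob_algebra (measure_pmf (embed_pmf w')))"
    by (simp add: space_prob_algebra measure_pmf.prob_space_axioms)
  have em: "emeasure \<nu> A = (\<integral>\<^sup>+i. ennreal (w i) * emeasure (Q i) A \<partial>count_space E)"
    if "A \<in> sets borel" for A
  proof -
    have "emeasure \<nu> A = (\<integral>\<^sup>+i. emeasure (Q' i) A \<partial>measure_pmf (embed_pmf w'))"
      unfolding \<nu>_def by (rule emeasure_bind_prob_algebra[OF M Q' that])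
    also have "\<dots> = (\<integral>\<^sup>+i. ennreal (w' i) * emeasure (Q' i) A \<partial>count_space UNIV)"
      by (simp add: nn_integral_measure_pmf pmf)
    also have "\<dots> = (\<integral>\<^sup>+i. ennreal (w i) * emeasure (Q i) A \<partial>count_space E)"
      by (subst nn_integral_count_space_indicator)
         (auto simp: w'_def Q'_def intro!: nn_integral_cong split: split_indicator)
    finally show ?thesis .
  qed
  have p: "prob_space \<nu>"
    unfolding \<nu>_def
  proof (rule measure_pmf.prob_space_bind)
    show "AE i in measure_pmf (embed_pmf w'). prob_space (Q' i)"
      by (rule AE_I2) (simp add: Q'_prob)
    show "Q' \<in> measurable (measure_pmf (embed_pmf w')) (subprob_algebra borel)"
      using Q' by (rule measurable_prob_algebraD)
  qed
  have sets: "sets \<nu> = sets borel"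
    unfolding \<nu>_def by (rule sets_bind) (simp_all add: Q'_sets)
  show ?thesis
    using that[of \<nu>] MixI_nn_integral[OF p sets Q w(1) em] by blast
qed

lemma ex_pos_weight:
  fixes w :: "'i \<Rightarrow> real"
  assumes "\<And>i. i \<in> E \<Longrightarrow> 0 \<le> w i" "(w has_sum 1) E"
  shows "\<exists>i\<in>E. 0 < w i"
proof (rule ccontr)
  assume "\<not> ?thesis"
  then have "(w has_sum 0) E" using assms(1) by (intro has_sum_0) force
  with assms(2) have "1 = (0::real)" by (rule has_sum_unique)
  then show False by simp
qed

lemma has_sum_move_weight:
  fixes w c :: "'i \<Rightarrow> real"
  assumes "((\<lambda>j. w j * c j) has_sum s) E" "i \<in> E" "l \<in> E"
  shows "((\<lambda>j. (w j + w i * (of_bool (j = l) - of_bool (j = i))) * c j) has_sum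
    (s + w i * (c l - c i))) E"
proof -
  have point: "((\<lambda>j. of_bool (j = x) * c j) has_sum c x) E" if "x \<in> E" for x
    by (rule has_sum_finite_neutralI[of "{x}"]) (use that in auto)
  have "((\<lambda>j. w j * c j + (w i * (of_bool (j = l) * c j) + (- w i) * (of_bool (j = i) * c j)))
    has_sum (s + (w i * c l + (- w i) * c i))) E"
    by (intro has_sum_add has_sum_cmult_right point assms)
  then show ?thesis by (simp add: algebra_simps)
qed

text \<open>If every component is an average of two others, a component of positive weight can hand this
  weight to either of the two. The resulting mixtures average to \<open>\<mu>\<close>, and the set \<open>B\<close> tells the
  first of them apart from \<open>\<mu>\<close>.\<close>

lemma not_extreme_if_components_split:
  assumes Q: "\<And>i. i \<in> E \<Longrightarrow> prob_space (Q i)" "\<And>i. i \<in> E \<Longrightarrow> sets (Q i) = sets borel"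
    and split: "\<And>i. i \<in> E \<Longrightarrow> \<exists>l\<in>E. \<exists>r\<in>E. (\<exists>B\<in>sets borel. measure (Q l) B \<noteq> measure (Q i) B) \<and>
      (\<forall>A\<in>sets borel. 2 * measure (Q i) A = measure (Q l) A + measure (Q r) A)"
  shows "\<not> extreme_element (Mix E Q) \<mu>"
proof
  assume ext: "extreme_element (Mix E Q) \<mu>"
  then have "\<mu> \<in> Mix E Q" by (simp add: extreme_element_def)
  then obtain w where sets: "sets \<mu> = sets borel"
    and w: "\<And>i. i \<in> E \<Longrightarrow> 0 \<le> w i" "(w has_sum 1) E"
    and mix: "\<And>A. A \<in> sets borel \<Longrightarrow> ((\<lambda>i. w i * measure (Q i) A) has_sum measure \<mu> A) E"
    unfolding Mix_def by blast
  obtain i where i: "i \<in> E" "w i > 0" using ex_pos_weight[OF w] by blast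
  have move: "\<exists>\<nu>\<in>Mix E Q. \<forall>A\<in>sets borel.
      measure \<nu> A = measure \<mu> A + w i * (measure (Q l) A - measure (Q i) A)"
    if l: "l \<in> E" for l
  proof -
    define v where "v j = w j + w i * (of_bool (j = l) - of_bool (j = i))" for j
    have v: "0 \<le> v j" if "j \<in> E" for j
      using w(1)[OF that] i by (auto simp: v_def)
    have v1: "(v has_sum 1) E"
      using has_sum_move_weight[of w "\<lambda>_. 1" E 1 i l] w(2) i(1) l by (simp add: v_def[abs_def])
    obtain \<nu> where \<nu>: "\<nu> \<in> Mix E Q"
      "\<And>A. A \<in> sets borel \<Longrightarrow> ((\<lambda>i. v i * measure (Q i) A) has_sum measure \<nu> A) E"
      using ex_mixture[of E Q v] Q v v1 by blast
    have "measure \<nu> A = measure \<mu> A + w i * (measure (Q l) A - measure (Q i) A)"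
      if A: "A \<in> sets borel" for A
      using has_sum_unique[OF \<nu>(2)[OF A]] has_sum_move_weight[OF mix[OF A] i(1) l]
      by (simp add: v_def[abs_def])
    with \<nu>(1) show ?thesis by blast
  qed
  obtain l r B where lr: "l \<in> E" "r \<in> E" and B: "B \<in> sets borel" "measure (Q l) B \<noteq> measure (Q i) B"
    and half: "\<And>A. A \<in> sets borel \<Longrightarrow> 2 * measure (Q i) A = measure (Q l) A + measure (Q r) A"
    using split[OF i(1)] by blast
  obtain \<nu>1 \<nu>2 where \<nu>: "\<nu>1 \<in> Mix E Q" "\<nu>2 \<in> Mix E Q"
    and 1: "\<And>A. A \<in> sets borel \<Longrightarrow>
      measure \<nu>1 A = measure \<mu> A + w i * (measure (Q l) A - measure (Q i) A)"
    and 2: "\<And>A. A \<in> sets borel \<Longrightarrow>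
      measure \<nu>2 A = measure \<mu> A + w i * (measure (Q r) A - measure (Q i) A)"
    using move[OF lr(1)] move[OF lr(2)] by blast
  have "measure \<mu> A = 1/2 * measure \<nu>1 A + (1 - 1/2) * measure \<nu>2 A" if A: "A \<in> sets borel" for A
  proof -
    have r: "measure (Q r) A = 2 * measure (Q i) A - measure (Q l) A" using half[OF A] by simp
    show ?thesis unfolding 1[OF A] 2[OF A] r by (simp add: field_simps)
  qed
  moreover have "0 < (1/2::real) \<and> 1/2 < (1::real) \<and> (\<forall>A\<in>sets \<mu>. measure \<mu> A =
      1/2 * measure \<nu>1 A + (1 - 1/2) * measure \<nu>2 A) \<longrightarrow> \<nu>1 = \<mu> \<and> \<nu>2 = \<mu>"
    using ext \<nu> unfolding extreme_element_def by blast
  ultimately have "\<nu>1 = \<mu>" using sets by simp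
  then have "w i * (measure (Q l) B - measure (Q i) B) = 0" using 1[OF B(1)] by simp
  then show False using i(2) B(2) by simp
qed

section \<open>Uniform distributions on dyadic intervals\<close>

lemma prob_space_unif: "p < q \<Longrightarrow> prob_space (unif p q)"
  unfolding unif_def by (rule prob_space_uniform_measure) auto

lemma sets_unif [simp]: "sets (unif p q) = sets borel"
  by (simp add: unif_def)

lemma emeasure_unif:
  assumes "p < q" "A \<in> sets borel"
  shows "emeasure (unif p q) A = emeasure lborel ({p<..<q} \<inter> A) / ennreal (q - p)"
  using assms by (simp add: unif_def)

lemma measure_unif:
  assumes "p < q" "A \<in> sets borel"
  shows "measure (unif p q) A = measure lborel ({p<..<q} \<inter> A) / (q - p)"
  using assms by (simp add: unif_def)

lemma unif_average_of_halves:
  assumes pq: "p < q" and A: "A \<in> sets borel"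
  defines "m \<equiv> (p + q) / 2"
  shows "2 * measure (unif p q) A = measure (unif p m) A + measure (unif m q) A"
proof -
  have m: "p < m" "m < q" using pq by (auto simp: m_def field_simps)
  define d where "d = m - p"
  have len: "m - p = d" "q - m = d" "q - p = 2 * d" by (simp_all add: d_def m_def field_simps)
  have fin: "{a<..<b} \<inter> A \<in> fmeasurable lborel" for a b :: real
    by (rule fmeasurableI2[OF fmeasurable_cbox[of a b]]) (use A in auto)
  have "measure lborel ({p<..<q} \<inter> A) = measure lborel (({p<..<m} \<inter> A) \<union> ({m<..<q} \<inter> A))"
  proof (rule measure_eq_AE)
    show "AE x in lborel. x \<in> {p<..<q} \<inter> A \<longleftrightarrow> x \<in> ({p<..<m} \<inter> A) \<union> ({m<..<q} \<inter> A)"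
      using AE_lborel_singleton[of m] by eventually_elim (use m in auto)
  qed (use A in auto)
  also have "\<dots> = measure lborel ({p<..<m} \<inter> A) + measure lborel ({m<..<q} \<inter> A)"
    by (intro measure_Un_AE fin) auto
  finally show ?thesis
    unfolding measure_unif[OF pq A] measure_unif[OF m(1) A] measure_unif[OF m(2) A] len
    by (simp add: add_divide_distrib)
qed

lemma dyadic_intervals_less: "(p, q) \<in> dyadic_intervals \<Longrightarrow> p < q"
  by (auto simp: dyadic_intervals_def)

lemma dyadic_intervals_halves:
  assumes "(p, q) \<in> dyadic_intervals"
  shows "(p, (p + q) / 2) \<in> dyadic_intervals" "((p + q) / 2, q) \<in> dyadic_intervals"
proof -
  obtain k m :: int where pq: "p = of_int k * 2 powi m" "q = (of_int k + 1) * 2 powi m"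
    using assms by (auto simp: dyadic_intervals_def)
  have pow: "2 powi m = 2 * (2::real) powi (m - 1)" by (simp add: power_int_diff)
  have "(p, (p + q) / 2) = (of_int (2 * k) * 2 powi (m - 1), (of_int (2 * k) + 1) * 2 powi (m - 1))"
    "((p + q) / 2, q) = (of_int (2 * k + 1) * 2 powi (m - 1), (of_int (2 * k + 1) + 1) * 2 powi (m - 1))"
    unfolding pq pow by (simp_all add: algebra_simps)
  then show "(p, (p + q) / 2) \<in> dyadic_intervals" "((p + q) / 2, q) \<in> dyadic_intervals"
    unfolding dyadic_intervals_def by blast+
qed

lemma Mix_dyadic_no_extreme: "\<not> extreme_element (Mix dyadic_intervals (\<lambda>(p, q). unif p q)) \<mu>"
proof (rule not_extreme_if_components_split)
  fix i assume i: "i \<in> dyadic_intervals"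
  obtain p q where pq: "i = (p, q)" by fastforce
  with i have less: "p < q" using dyadic_intervals_less by blast
  define m where "m = (p + q) / 2"
  have m: "p < m" "m < q" using less by (auto simp: m_def field_simps)
  then have "measure (unif p m) {p<..<m} = 1" "measure (unif p q) {p<..<m} = (m - p) / (q - p)"
    using less by (simp_all add: measure_unif min_def max_def)
  moreover have "(m - p) / (q - p) \<noteq> 1" using m less by (simp add: field_simps)
  ultimately have "measure (unif p m) {p<..<m} \<noteq> measure (unif p q) {p<..<m}" by simp
  moreover have "(p, m) \<in> dyadic_intervals" "(m, q) \<in> dyadic_intervals"
    using dyadic_intervals_halves i pq by (auto simp: m_def)
  ultimately show "\<exists>l\<in>dyadic_intervals. \<exists>r\<in>dyadic_intervals.
      (\<exists>B\<in>sets borel. measure (case l of (p, q) \<Rightarrow> unif p q) B \<noteq> measure (case i of (p, q) \<Rightarrow> unif p q) B) \<and>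
      (\<forall>A\<in>sets borel. 2 * measure (case i of (p, q) \<Rightarrow> unif p q) A =
        measure (case l of (p, q) \<Rightarrow> unif p q) A + measure (case r of (p, q) \<Rightarrow> unif p q) A)"
    using unif_average_of_halves[OF less] pq
    by (intro bexI[of _ "(p, m)"] bexI[of _ "(m, q)"] conjI bexI[of _ "{p<..<m}"]) (auto simp: m_def)
qed (auto simp: prob_space_unif dyadic_intervals_less)

section \<open>An absolutely continuous measure outside the mixtures\<close>

text \<open>The rationals are null, so they are contained in an open set \<open>U\<close> of measure less than 1.
  The uniform distribution on the rest of the unit interval does not charge \<open>U\<close>, whereas
  \<open>U\<close> meets every interval in a nonempty open set.\<close>

lemma ex_absolutely_continuous_not_Mix:
  "\<exists>\<mu> :: real measure. prob_space \<mu> \<and> sets \<mu> = sets borel \<and> absolutely_continuous lborel \<mu> \<and>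
      \<mu> \<notin> Mix dyadic_intervals (\<lambda>(p, q). unif p q)"
proof -
  have null: "emeasure lborel (\<rat> :: real set) = 0"
    using emeasure_lborel_countable[OF countable_rat] .
  have Qb: "(\<rat> :: real set) \<in> sets borel"
    using countable_rat by (rule sets.countable[rotated]) auto
  obtain U :: "real set" where U: "open U" "\<rat> \<subseteq> U" "emeasure lborel (U - \<rat>) < ennreal 1"
    using outer_regular_lborel[OF Qb, of 1] by auto
  have [measurable]: "U \<in> sets borel" using U(1) by auto
  have "emeasure lborel U \<le> emeasure lborel (U - \<rat>) + emeasure lborel (\<rat> :: real set)"
    using emeasure_subadditive[of "U - \<rat>" lborel \<rat>] Qb U(2) by (simp add: Un_absorb1 Un_commute)
  then have U1: "emeasure lborel U < 1" using U(3) null by simp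
  define C where "C = {0..1} - U"
  have [measurable]: "C \<in> sets borel" by (auto simp: C_def)
  have C0: "emeasure lborel C \<noteq> 0"
  proof
    assume "emeasure lborel C = 0"
    have "emeasure lborel {0..1::real} \<le> emeasure lborel (C \<union> U)"
      by (intro emeasure_mono) (auto simp: C_def)
    also have "\<dots> \<le> emeasure lborel C + emeasure lborel U"
      by (intro emeasure_subadditive) auto
    also have "\<dots> < 1" using U1 \<open>emeasure lborel C = 0\<close> by simp
    finally show False by simp
  qed
  have "emeasure lborel C \<le> emeasure lborel {0..1::real}"
    by (intro emeasure_mono) (auto simp: C_def)
  then have Cfin: "emeasure lborel C \<noteq> \<infinity>" by (auto simp: top_unique)
  define \<mu> where "\<mu> = uniform_measure lborel C"
  have "prob_space \<mu>" unfolding \<mu>_def using C0 Cfin by (rule prob_space_uniform_measure)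
  moreover have "sets \<mu> = sets borel" by (simp add: \<mu>_def)
  moreover have "absolutely_continuous lborel \<mu>"
    unfolding \<mu>_def uniform_measure_def by (intro absolutely_continuousI_density) auto
  moreover have "\<mu> \<notin> Mix dyadic_intervals (\<lambda>(p, q). unif p q)"
  proof
    assume "\<mu> \<in> Mix dyadic_intervals (\<lambda>(p, q). unif p q)"
    then obtain w where w: "\<And>i. i \<in> dyadic_intervals \<Longrightarrow> 0 \<le> w i" "(w has_sum 1) dyadic_intervals"
      and mix: "((\<lambda>i. w i * measure (case i of (p, q) \<Rightarrow> unif p q) U) has_sum measure \<mu> U) dyadic_intervals"
      unfolding Mix_def using \<open>U \<in> sets borel\<close> by blast
    have "C \<inter> U = {}" by (auto simp: C_def)
    then have "measure \<mu> U = 0"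
      unfolding \<mu>_def by (subst measure_uniform_measure[OF C0 Cfin]) auto
    then have zero: "w i * measure (case i of (p, q) \<Rightarrow> unif p q) U = 0" if "i \<in> dyadic_intervals" for i
      using nonneg_has_sum_le_0D[OF mix] w(1) that by auto
    obtain i where i: "i \<in> dyadic_intervals" "0 < w i" using ex_pos_weight[OF w] by blast
    obtain p q where pq: "i = (p, q)" by fastforce
    with i(1) have less: "p < q" using dyadic_intervals_less by blast
    obtain x where "x \<in> \<rat>" "p < x" "x < q" using Rats_dense_in_real[OF less] by blast
    then have "{p<..<q} \<inter> U \<noteq> {}" using U(2) by auto
    moreover have "open ({p<..<q} \<inter> U)" using U(1) by auto
    ultimately have "{p<..<q} \<inter> U \<notin> null_sets lebesgue"
      using open_not_negligible negligible_iff_null_sets by blast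
    then have "emeasure lborel ({p<..<q} \<inter> U) \<noteq> 0"
      using null_sets_completionI[of "{p<..<q} \<inter> U" lborel] by (auto intro!: null_setsI)
    moreover have "emeasure lborel ({p<..<q} \<inter> U) \<noteq> \<infinity>"
      using emeasure_mono[of "{p<..<q} \<inter> U" "{p<..<q}" lborel] less by (auto simp: top_unique)
    ultimately have "measure lborel ({p<..<q} \<inter> U) \<noteq> 0"
      by (simp add: measure_def enn2real_eq_0_iff)
    then show False using zero[OF i(1)] i(2) pq less by (simp add: measure_unif)
  qed
  ultimately show ?thesis by blast
qed

section \<open>Essential infima\<close>

text \<open>The supremum is taken in the reals, so it is the essential infimum of \<open>f\<close> over \<open>K\<close> only
  if the set of lower bounds is nonempty and bounded above. For the first, \<open>f\<close> is assumed to be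
  nonnegative almost everywhere below; for the second, \<open>K\<close> is assumed not to be null.\<close>

definition lborel_essinf :: "(real \<Rightarrow> real) \<Rightarrow> real set \<Rightarrow> real" where
  "lborel_essinf f K = Sup {c. AE x in lborel. x \<in> K \<longrightarrow> c \<le> f x}"

context
  fixes f :: "real \<Rightarrow> real" and K :: "real set"
  assumes nonneg: "AE x in lborel. 0 \<le> f x"
    and not_null: "\<not> (AE x in lborel. x \<notin> K)"
begin

text \<open>Otherwise \<open>f\<close> would exceed every natural number almost everywhere on \<open>K\<close>.\<close>

lemma bdd_above_ae_lower_bounds: "bdd_above {c. AE x in lborel. x \<in> K \<longrightarrow> c \<le> f x}"
proof (rule ccontr)
  assume unbdd: "\<not> ?thesis"
  have "AE x in lborel. x \<in> K \<longrightarrow> real n \<le> f x" for n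
  proof -
    obtain c where "AE x in lborel. x \<in> K \<longrightarrow> c \<le> f x" "real n < c"
      using unbdd by (auto simp: bdd_above_def not_le)
    then show ?thesis by (auto elim!: eventually_mono)
  qed
  then have "AE x in lborel. \<forall>n. x \<in> K \<longrightarrow> real n \<le> f x"
    unfolding AE_all_countable by (rule allI)
  then have "AE x in lborel. x \<notin> K"
    by eventually_elim (metis reals_Archimedean2 not_le)
  then show False using not_null by simp
qed

lemma lborel_essinf_greatest:
  "AE x in lborel. x \<in> K \<longrightarrow> c \<le> f x \<Longrightarrow> c \<le> lborel_essinf f K"
  unfolding lborel_essinf_def by (rule cSup_upper[OF _ bdd_above_ae_lower_bounds]) simp

lemma lborel_essinf_nonneg: "0 \<le> lborel_essinf f K"
  by (rule lborel_essinf_greatest) (use nonneg in auto)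

text \<open>The supremum is attained: it is the limit of a sequence of lower bounds, and the exceptional
  null sets of a sequence have a null union.\<close>

lemma AE_lborel_essinf_le: "AE x in lborel. x \<in> K \<longrightarrow> lborel_essinf f K \<le> f x"
proof -
  have "AE x in lborel. x \<in> K \<longrightarrow> lborel_essinf f K - 1 / real (Suc n) \<le> f x" for n
  proof -
    have "lborel_essinf f K - 1 / real (Suc n) < Sup {c. AE x in lborel. x \<in> K \<longrightarrow> c \<le> f x}"
      unfolding lborel_essinf_def by simp
    moreover have "{c. AE x in lborel. x \<in> K \<longrightarrow> c \<le> f x} \<noteq> {}"
      using nonneg by (auto intro!: exI[of _ 0])
    ultimately obtain c where "AE x in lborel. x \<in> K \<longrightarrow> c \<le> f x" "lborel_essinf f K - 1 / real (Suc n) < c"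
      using less_cSup_iff[OF _ bdd_above_ae_lower_bounds] by auto
    then show ?thesis by (auto elim!: eventually_mono)
  qed
  then have "AE x in lborel. \<forall>n. x \<in> K \<longrightarrow> lborel_essinf f K - 1 / real (Suc n) \<le> f x"
    unfolding AE_all_countable by (rule allI)
  then show ?thesis
  proof eventually_elim
    case (elim x)
    show ?case
    proof (rule impI, rule field_le_epsilon)
      fix e :: real assume "x \<in> K" "0 < e"
      obtain n where "1 / real (Suc n) < e"
        using nat_approx_posE[OF \<open>0 < e\<close>] .
      with elim[rule_format, OF \<open>x \<in> K\<close>, of n] show "lborel_essinf f K \<le> f x + e" by linarith
    qed
  qed
qed

text \<open>This supplies the tags of the Riemann sums that are compared with integrals of step functions.\<close>

lemma ex_less_lborel_essinf_add:
  assumes "0 < e"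
  shows "\<exists>t\<in>K. f t < lborel_essinf f K + e"
proof (rule ccontr)
  assume "\<not> ?thesis"
  then have "lborel_essinf f K + e \<le> lborel_essinf f K"
    by (intro lborel_essinf_greatest) (auto simp: not_less)
  then show False using assms by simp
qed

end

section \<open>Dyadic step functions below a density\<close>

text \<open>Half-open cells of one level partition the line, so the cell of a point \<open>x\<close> is given by a floor
  and a step function has the form \<open>c \<lfloor>x * 2 ^ n\<rfloor>\<close>.\<close>

definition dyadic_cell :: "nat \<Rightarrow> int \<Rightarrow> real set" where
  "dyadic_cell n k = {x. \<lfloor>x * 2 ^ n\<rfloor> = k}"

lemma dyadic_cell_eq: "dyadic_cell n k = {of_int k / 2 ^ n ..< (of_int k + 1) / 2 ^ n}"
  by (auto simp: dyadic_cell_def floor_eq_iff field_simps)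

lemma sets_dyadic_cell [measurable]: "dyadic_cell n k \<in> sets borel"
  by (simp add: dyadic_cell_eq)

lemma emeasure_dyadic_cell: "emeasure lborel (dyadic_cell n k) = ennreal (1 / 2 ^ n)"
  by (simp add: dyadic_cell_eq divide_right_mono diff_divide_distrib[symmetric])

lemma dyadic_cell_not_null: "\<not> (AE x in lborel. x \<notin> dyadic_cell n k)"
proof
  assume "AE x in lborel. x \<notin> dyadic_cell n k"
  then have "emeasure lborel (dyadic_cell n k) = 0"
    by (subst (asm) AE_iff_measurable[OF _ refl]) auto
  then show False by (simp add: emeasure_dyadic_cell)
qed

lemma floor_mult_power2_Suc_div:
  fixes x :: real
  shows "\<lfloor>x * 2 ^ Suc n\<rfloor> div 2 = \<lfloor>x * 2 ^ n\<rfloor>"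
  using floor_divide_real_eq_div[of 2 "x * 2 ^ Suc n"] by simp

lemma dyadic_cell_Suc_subset: "dyadic_cell (Suc n) k \<subseteq> dyadic_cell n (k div 2)"
  using floor_mult_power2_Suc_div by (auto simp: dyadic_cell_def)

definition cell_essinf :: "(real \<Rightarrow> real) \<Rightarrow> nat \<Rightarrow> int \<Rightarrow> real" where
  "cell_essinf f n k = lborel_essinf f (dyadic_cell n k)"

text \<open>The parent of cell \<open>k\<close> has index \<open>k div 2\<close> on the previous level.\<close>

fun cell_increment :: "(real \<Rightarrow> real) \<Rightarrow> nat \<Rightarrow> int \<Rightarrow> real" where
  "cell_increment f 0 k = cell_essinf f 0 k"
| "cell_increment f (Suc n) k = cell_essinf f (Suc n) k - cell_essinf f n (k div 2)"

lemma sum_cell_increment: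
  fixes x :: real
  shows "(\<Sum>i\<le>n. cell_increment f i \<lfloor>x * 2 ^ i\<rfloor>) = cell_essinf f n \<lfloor>x * 2 ^ n\<rfloor>"
proof (induction n)
  case (Suc n)
  have "(\<Sum>i\<le>Suc n. cell_increment f i \<lfloor>x * 2 ^ i\<rfloor>)
    = cell_essinf f n \<lfloor>x * 2 ^ n\<rfloor> + cell_increment f (Suc n) \<lfloor>x * 2 ^ Suc n\<rfloor>"
    using Suc by simp
  also have "\<dots> = cell_essinf f (Suc n) \<lfloor>x * 2 ^ Suc n\<rfloor>"
    by (simp only: cell_increment.simps floor_mult_power2_Suc_div)
  finally show ?case .
qed simp

lemma cell_essinf_nonneg:
  "AE x in lborel. 0 \<le> f x \<Longrightarrow> 0 \<le> cell_essinf f n k"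
  unfolding cell_essinf_def by (intro lborel_essinf_nonneg dyadic_cell_not_null)

text \<open>Passing to a subset cannot decrease the essential infimum.\<close>

lemma cell_increment_nonneg:
  assumes "AE x in lborel. 0 \<le> f x"
  shows "0 \<le> cell_increment f n k"
proof (cases n)
  case 0
  then show ?thesis using cell_essinf_nonneg[OF assms] by simp
next
  case (Suc m)
  have "AE x in lborel. x \<in> dyadic_cell (Suc m) k \<longrightarrow> cell_essinf f m (k div 2) \<le> f x"
    using AE_lborel_essinf_le[OF assms dyadic_cell_not_null, of m "k div 2"]
    by eventually_elim (use dyadic_cell_Suc_subset in \<open>auto simp: cell_essinf_def\<close>)
  then have "cell_essinf f m (k div 2) \<le> cell_essinf f (Suc m) k"
    unfolding cell_essinf_def[of f "Suc m"]
    by (rule lborel_essinf_greatest[OF assms dyadic_cell_not_null])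
  then show ?thesis using Suc by simp
qed

lemma AE_cell_essinf_le:
  assumes "AE x in lborel. 0 \<le> f x"
  shows "AE x in lborel. \<forall>n. cell_essinf f n \<lfloor>x * 2 ^ n\<rfloor> \<le> f x"
proof -
  have "AE x in lborel. \<forall>n k. x \<in> dyadic_cell n k \<longrightarrow> cell_essinf f n k \<le> f x"
    unfolding AE_all_countable cell_essinf_def
    by (intro allI AE_lborel_essinf_le assms dyadic_cell_not_null)
  then show ?thesis by eventually_elim (simp add: dyadic_cell_def)
qed

lemma suminf_cell_increment:
  fixes x :: real
  assumes "AE x in lborel. 0 \<le> f x"
  shows "(\<Sum>i. ennreal (cell_increment f i \<lfloor>x * 2 ^ i\<rfloor>)) = (SUP n. ennreal (cell_essinf f n \<lfloor>x * 2 ^ n\<rfloor>))"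
proof -
  have "(\<Sum>i\<le>n. ennreal (cell_increment f i \<lfloor>x * 2 ^ i\<rfloor>)) = ennreal (cell_essinf f n \<lfloor>x * 2 ^ n\<rfloor>)" for n
    by (subst sum_ennreal) (simp_all add: sum_cell_increment cell_increment_nonneg[OF assms])
  moreover have "(\<Sum>i. ennreal (cell_increment f i \<lfloor>x * 2 ^ i\<rfloor>))
    = (SUP n. \<Sum>i\<le>n. ennreal (cell_increment f i \<lfloor>x * 2 ^ i\<rfloor>))"
    by (intro LIMSEQ_unique[OF summable_LIMSEQ' LIMSEQ_SUP]) (auto intro!: incseq_SucI)
  ultimately show ?thesis by simp
qed

lemma measurable_floor_cell [measurable]:
  fixes c :: "int \<Rightarrow> 'b :: topological_space"
  shows "(\<lambda>x::real. c \<lfloor>x * 2 ^ n\<rfloor>) \<in> borel_measurable borel"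
  by (rule measurable_compose[where N = "count_space UNIV"]) auto

section \<open>Convergence of the step functions to a Riemann integrable density\<close>

text \<open>A uniform mesh bound \<open>d\<close> is a constant gauge: a set inside a ball of radius \<open>d / 3\<close> has
  diameter at most \<open>2 * d / 3\<close>. So the Riemann integral is the Henstock--Kurzweil integral, which
  for an integrable density is the Lebesgue integral.\<close>

lemma riemann_integrable_imp_has_integral:
  assumes bound: "\<And>e. 0 < e \<Longrightarrow> \<exists>d>0. \<forall>D. D tagged_division_of {a..b} \<and> (\<forall>(x, K)\<in>D. diameter K < d) \<longrightarrow>
        \<bar>(\<Sum>(x, K)\<in>D. measure lborel K * f x) - I\<bar> < e"
  shows "(f has_integral I) {a..b::real}"
  unfolding has_integral_real
proof (intro allI impI)
  fix e :: real assume "0 < e"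
  then obtain d where d: "0 < d" and
    D: "\<And>D. D tagged_division_of {a..b} \<Longrightarrow> (\<forall>(x, K)\<in>D. diameter K < d) \<Longrightarrow>
        \<bar>(\<Sum>(x, K)\<in>D. measure lborel K * f x) - I\<bar> < e"
    using bound by meson
  show "\<exists>\<gamma>. gauge \<gamma> \<and> (\<forall>\<D>. \<D> tagged_division_of {a..b} \<and> \<gamma> fine \<D> \<longrightarrow>
      norm ((\<Sum>(x, K)\<in>\<D>. measure lborel K *\<^sub>R f x) - I) < e)"
  proof (intro exI conjI allI impI)
    show "gauge (\<lambda>x. ball x (d / 3))" using d by (intro gauge_ball) simp
    fix \<D> assume \<D>: "\<D> tagged_division_of {a..b} \<and> (\<lambda>x. ball x (d / 3)) fine \<D>"
    have "diameter K < d" if "(x, K) \<in> \<D>" for x K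
    proof -
      have "K \<subseteq> ball x (d / 3)" using \<D> that by (auto dest: fineD)
      then have "diameter K \<le> diameter (ball x (d / 3))"
        by (rule diameter_subset) simp
      also have "\<dots> < d" using d by simp
      finally show ?thesis .
    qed
    then show "norm ((\<Sum>(x, K)\<in>\<D>. measure lborel K *\<^sub>R f x) - I) < e"
      using D[of \<D>] \<D> by auto
  qed
qed

lemma floor_mult_power2_mem_iff:
  fixes k :: int and x :: real
  shows "\<lfloor>x * 2 ^ n\<rfloor> \<in> {k * 2 ^ n ..< (k + 1) * 2 ^ n} \<longleftrightarrow> x \<in> {of_int k ..< of_int k + 1}"
proof -
  have "0 < (2 ^ n :: real)" by simp
  then have "of_int k * 2 ^ n \<le> x * 2 ^ n \<longleftrightarrow> of_int k \<le> x"
    "x * 2 ^ n < (of_int k + 1) * 2 ^ n \<longleftrightarrow> x < of_int k + 1"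
    by (rule mult_le_cancel_right_pos, rule mult_less_cancel_right_pos)
  then show ?thesis
    unfolding atLeastLessThan_iff le_floor_iff floor_less_iff of_int_mult of_int_power of_int_numeral
      of_int_add of_int_1 by (rule arg_cong2)
qed

lemma dyadic_cells_tagged_division:
  fixes k :: int and n :: nat
  defines "J \<equiv> {k * 2 ^ n ..< (k + 1) * 2 ^ n}"
  defines "L \<equiv> \<lambda>j. {of_int j / 2 ^ n .. (of_int j + 1) / 2 ^ n :: real}"
  assumes t: "\<And>j. t j \<in> dyadic_cell n j"
  shows "(\<lambda>j. (t j, L j)) ` J tagged_division_of {of_int k .. of_int k + 1}"
proof -
  have L_subset: "L j \<subseteq> {of_int k .. of_int k + 1}" if "j \<in> J" for j
  proof -
    have "k * 2 ^ n \<le> j" "j + 1 \<le> (k + 1) * 2 ^ n" using that by (auto simp: J_def)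
    then have "real_of_int (k * 2 ^ n) \<le> of_int j" "real_of_int (j + 1) \<le> of_int ((k + 1) * 2 ^ n)"
      by (simp_all only: of_int_le_iff)
    then have "of_int k \<le> of_int j / (2 ^ n :: real)" "(of_int j + 1) / 2 ^ n \<le> (of_int k + 1 :: real)"
      by (simp_all add: field_simps)
    then show ?thesis by (auto simp: L_def)
  qed
  have cell_subset: "dyadic_cell n j \<subseteq> L j" for j
    by (auto simp: dyadic_cell_eq L_def)
  show ?thesis
  proof (rule tagged_division_ofI)
    show "finite ((\<lambda>j. (t j, L j)) ` J)" by (simp add: J_def)
  next
    fix x K assume "(x, K) \<in> (\<lambda>j. (t j, L j)) ` J"
    then obtain j where j: "j \<in> J" "x = t j" "K = L j" by auto
    show "x \<in> K" using t[of j] cell_subset j by auto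
    show "K \<subseteq> {of_int k .. of_int k + 1}" using L_subset j by simp
    show "\<exists>a b. K = cbox a b" using j by (auto simp: L_def)
  next
    fix x1 K1 x2 K2 assume *: "(x1, K1) \<in> (\<lambda>j. (t j, L j)) ` J" "(x2, K2) \<in> (\<lambda>j. (t j, L j)) ` J"
      "(x1, K1) \<noteq> (x2, K2)"
    then obtain i j where ij: "K1 = L i" "K2 = L j" "i \<noteq> j" by auto
    have "interior (L i) \<subseteq> dyadic_cell n i" for i
      by (auto simp: L_def dyadic_cell_eq)
    moreover have "dyadic_cell n i \<inter> dyadic_cell n j = {}"
      using ij by (auto simp: dyadic_cell_def)
    ultimately show "interior K1 \<inter> interior K2 = {}" using ij by blast
  next
    have "x \<in> \<Union>(L ` J)" if x: "x \<in> {of_int k .. of_int k + 1}" for x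
    proof (cases "x = of_int k + 1")
      case True
      \<comment> \<open>This point lies in no half-open cell with index in \<open>J\<close>, but in the closure of the last one.\<close>
      have "real_of_int ((k + 1) * 2 ^ n - 1) / 2 ^ n \<le> of_int k + 1" by (simp add: field_simps)
      then have "x \<in> L ((k + 1) * 2 ^ n - 1)" unfolding True L_def by simp
      moreover have "(k + 1) * 2 ^ n - 1 \<in> J" by (auto simp: J_def algebra_simps)
      ultimately show ?thesis by blast
    next
      case False
      have "x \<in> L \<lfloor>x * 2 ^ n\<rfloor>"
        using cell_subset[of "\<lfloor>x * 2 ^ n\<rfloor>"] by (auto simp: dyadic_cell_def)
      moreover have "\<lfloor>x * 2 ^ n\<rfloor> \<in> J"
        unfolding J_def floor_mult_power2_mem_iff using x False by simp
      ultimately show ?thesis by blast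
    qed
    then have "(\<Union>j\<in>J. L j) = {of_int k .. of_int k + 1}"
      by (intro equalityI UN_least L_subset subsetI)
    moreover have "\<Union>{K. \<exists>x. (x, K) \<in> (\<lambda>j. (t j, L j)) ` J} = (\<Union>j\<in>J. L j)" by auto
    ultimately show "\<Union>{K. \<exists>x. (x, K) \<in> (\<lambda>j. (t j, L j)) ` J} = {of_int k .. of_int k + 1}" by simp
  qed
qed

lemma nn_integral_cell_essinf:
  fixes k :: int
  assumes nonneg: "AE x in lborel. 0 \<le> f x"
  shows "(\<integral>\<^sup>+x\<in>{of_int k ..< of_int k + 1 :: real}. ennreal (cell_essinf f n \<lfloor>x * 2 ^ n\<rfloor>) \<partial>lborel)
    = ennreal (\<Sum>j\<in>{k * 2 ^ n ..< (k + 1) * 2 ^ n}. cell_essinf f n j / 2 ^ n)"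
proof -
  let ?J = "{k * 2 ^ n ..< (k + 1) * 2 ^ n}"
  have "(\<integral>\<^sup>+x\<in>{of_int k ..< of_int k + 1 :: real}. ennreal (cell_essinf f n \<lfloor>x * 2 ^ n\<rfloor>) \<partial>lborel)
    = (\<integral>\<^sup>+x. (\<Sum>j\<in>?J. ennreal (cell_essinf f n j) * indicator (dyadic_cell n j) x) \<partial>lborel)"
  proof (intro nn_integral_cong)
    fix x :: real
    have "(\<Sum>j\<in>?J. ennreal (cell_essinf f n j) * indicator (dyadic_cell n j) x)
      = (\<Sum>j\<in>?J. if j = \<lfloor>x * 2 ^ n\<rfloor> then ennreal (cell_essinf f n j) else 0)"
      by (intro sum.cong) (auto simp: dyadic_cell_def indicator_def)
    also have "\<dots> = ennreal (cell_essinf f n \<lfloor>x * 2 ^ n\<rfloor>) * indicator {of_int k ..< of_int k + 1} x"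
      by (simp only: sum.delta finite_atLeastLessThan_int floor_mult_power2_mem_iff)
         (simp add: indicator_def)
    finally show "ennreal (cell_essinf f n \<lfloor>x * 2 ^ n\<rfloor>) * indicator {of_int k ..< of_int k + 1} x
      = (\<Sum>j\<in>?J. ennreal (cell_essinf f n j) * indicator (dyadic_cell n j) x)" ..
  qed
  also have "\<dots> = (\<Sum>j\<in>?J. ennreal (cell_essinf f n j) * emeasure lborel (dyadic_cell n j))"
    by (subst nn_integral_sum) (simp_all add: nn_integral_cmult_indicator)
  also have "\<dots> = (\<Sum>j\<in>?J. ennreal (cell_essinf f n j / 2 ^ n))"
    by (intro sum.cong refl)
       (simp add: emeasure_dyadic_cell ennreal_mult[symmetric] cell_essinf_nonneg[OF nonneg])
  also have "\<dots> = ennreal (\<Sum>j\<in>?J. cell_essinf f n j / 2 ^ n)"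
    by (rule sum_ennreal) (simp add: cell_essinf_nonneg[OF nonneg])
  finally show ?thesis .
qed

text \<open>Tag every cell with a point where \<open>f\<close> exceeds the essential infimum by less than \<open>e / 2\<close>. On a
  fine level the Riemann sum is within \<open>e / 2\<close> of the integral, and replacing the tag values
  by the essential infima costs at most another \<open>e / 2\<close>, as the cells have total length 1.\<close>

lemma integral_le_cell_essinf_sum:
  fixes k :: int
  assumes nonneg: "AE x in lborel. 0 \<le> f x"
    and riemann: "f riemann_integrable_on {of_int k .. of_int k + 1}"
    and "0 < e"
  shows "\<exists>n. integral {of_int k .. of_int k + 1} f - e
    \<le> (\<Sum>j\<in>{k * 2 ^ n ..< (k + 1) * 2 ^ n}. cell_essinf f n j / 2 ^ n)"
proof -
  define S where "S = {of_int k .. of_int k + 1 :: real}"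
  obtain I where I: "\<And>e. 0 < e \<Longrightarrow> \<exists>d>0. \<forall>D. D tagged_division_of S \<and> (\<forall>(x, K)\<in>D. diameter K < d) \<longrightarrow>
        \<bar>(\<Sum>(x, K)\<in>D. measure lborel K * f x) - I\<bar> < e"
    using riemann unfolding riemann_integrable_on_def S_def by blast
  have "(f has_integral I) S"
    using riemann_integrable_imp_has_integral[of "of_int k" "of_int k + 1" f I] I by (simp add: S_def)
  then have I_eq: "integral S f = I" by (rule integral_unique)
  obtain d where d: "0 < d" and
    D: "\<And>D. D tagged_division_of S \<Longrightarrow> (\<forall>(x, K)\<in>D. diameter K < d) \<Longrightarrow>
        \<bar>(\<Sum>(x, K)\<in>D. measure lborel K * f x) - I\<bar> < e / 2"
    using I[of "e / 2"] \<open>0 < e\<close> half_gt_zero[of e] by blast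
  obtain n where n: "(1 / 2) ^ n < d"
    using real_arch_pow_inv[OF d, of "1 / 2"] by auto
  define J where "J = {k * 2 ^ n ..< (k + 1) * 2 ^ n}"
  define L where "L j = {of_int j / 2 ^ n .. (of_int j + 1) / 2 ^ n :: real}" for j
  have "\<exists>t\<in>dyadic_cell n j. f t < cell_essinf f n j + e / 2" for j
    unfolding cell_essinf_def
    using ex_less_lborel_essinf_add[OF nonneg dyadic_cell_not_null] \<open>0 < e\<close> by simp
  then obtain t where t: "\<And>j. t j \<in> dyadic_cell n j" "\<And>j. f (t j) < cell_essinf f n j + e / 2"
    by metis
  have len: "(of_int j + 1) / 2 ^ n - of_int j / 2 ^ n = (1 / 2 ^ n :: real)" for j
    by (simp add: add_divide_distrib)
  have le: "of_int j / 2 ^ n \<le> (of_int j + 1) / (2 ^ n :: real)" for j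
    by (simp add: divide_right_mono)
  have inj: "inj_on (\<lambda>j. (t j, L j)) J"
  proof (rule inj_onI)
    have floor: "\<lfloor>t j * 2 ^ n\<rfloor> = j" for j using t(1)[of j] by (simp add: dyadic_cell_def)
    fix i j assume "(t i, L i) = (t j, L j)"
    then have "\<lfloor>t i * 2 ^ n\<rfloor> = \<lfloor>t j * 2 ^ n\<rfloor>" by (simp only: prod.inject)
    then show "i = j" unfolding floor .
  qed
  have "\<bar>(\<Sum>(x, K)\<in>(\<lambda>j. (t j, L j)) ` J. measure lborel K * f x) - I\<bar> < e / 2"
  proof (rule D)
    show "(\<lambda>j. (t j, L j)) ` J tagged_division_of S"
      using dyadic_cells_tagged_division[OF t(1)] by (simp add: J_def L_def S_def)
    have "diameter (L j) < d" for j
      using n d by (simp add: L_def diameter_closed_interval len power_one_over)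
    then show "\<forall>(x, K)\<in>(\<lambda>j. (t j, L j)) ` J. diameter K < d" by auto
  qed
  also have "(\<Sum>(x, K)\<in>(\<lambda>j. (t j, L j)) ` J. measure lborel K * f x) = (\<Sum>j\<in>J. f (t j) / 2 ^ n)"
    by (subst sum.reindex[OF inj]) (simp add: L_def le len)
  finally have "I - e / 2 < (\<Sum>j\<in>J. f (t j) / 2 ^ n)" by linarith
  also have "\<dots> \<le> (\<Sum>j\<in>J. (cell_essinf f n j + e / 2) / 2 ^ n)"
    using t(2) by (intro sum_mono divide_right_mono less_imp_le) auto
  also have "\<dots> = (\<Sum>j\<in>J. cell_essinf f n j / 2 ^ n) + real (card J) * (e / 2 / 2 ^ n)"
    by (simp only: add_divide_distrib sum.distrib sum_constant)
  also have "real (card J) = 2 ^ n"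
    by (simp add: J_def algebra_simps nat_power_eq)
  finally have "I - e \<le> (\<Sum>j\<in>J. cell_essinf f n j / 2 ^ n)" by simp
  then show ?thesis using I_eq by (auto simp: J_def S_def)
qed

text \<open>The limit \<open>G\<close> of the step functions is at most \<open>f\<close>. Were it smaller on a set of positive
  measure, then on some unit interval its integral would be smaller than that of \<open>f\<close>; but the step
  functions already have integrals arbitrarily close to that of \<open>f\<close>.\<close>

lemma AE_SUP_cell_essinf:
  assumes f: "integrable lborel f" and nonneg: "AE x in lborel. 0 \<le> f x"
    and riemann: "\<And>k :: int. f riemann_integrable_on {of_int k .. of_int k + 1}"
  shows "AE x in lborel. (SUP n. ennreal (cell_essinf f n \<lfloor>x * 2 ^ n\<rfloor>)) = ennreal (f x)"
proof -
  define G where "G x = (SUP n. ennreal (cell_essinf f n \<lfloor>x * 2 ^ n\<rfloor>))" for x :: real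
  have [measurable]: "f \<in> borel_measurable borel" using f by simp
  have [measurable]: "G \<in> borel_measurable borel" unfolding G_def by measurable
  have G_le: "AE x in lborel. G x \<le> ennreal (f x)"
    using AE_cell_essinf_le[OF nonneg]
    by eventually_elim (auto simp: G_def intro!: SUP_least ennreal_leI)
  have "AE x in lborel. x \<in> {of_int k ..< of_int k + 1} \<longrightarrow> ennreal (f x) \<le> G x" for k :: int
  proof (rule ccontr)
    define S where "S = {of_int k ..< of_int k + 1 :: real}"
    define T where "T = {of_int k .. of_int k + 1 :: real}"
    assume "\<not> (AE x in lborel. x \<in> {of_int k ..< of_int k + 1} \<longrightarrow> ennreal (f x) \<le> G x)"
    moreover have "AE x in lborel. x \<in> {of_int k ..< of_int k + 1} \<longrightarrow> ennreal (f x) \<le> G x"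
      if "AE x in lborel. ennreal (f x) * indicator S x \<le> G x * indicator S x"
      using that by eventually_elim (auto simp: S_def)
    ultimately have not_AE: "\<not> (AE x in lborel. ennreal (f x) * indicator S x \<le> G x * indicator S x)"
      by blast
    have fT: "set_integrable lborel T f"
      unfolding set_integrable_def T_def by (intro integrable_mult_indicator f) auto
    have "(\<integral>\<^sup>+x. ennreal (f x) * indicator S x \<partial>lborel) = (\<integral>\<^sup>+x. ennreal (indicator T x *\<^sub>R f x) \<partial>lborel)"
      using AE_lborel_singleton[of "of_int k + 1"]
      by (intro nn_integral_cong_AE) (auto simp: S_def T_def indicator_def elim!: eventually_mono)
    also have "\<dots> = ennreal (LINT x:T|lborel. f x)"
      unfolding set_lebesgue_integral_def
      by (intro nn_integral_eq_integral fT[unfolded set_integrable_def])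
         (use nonneg in \<open>auto simp: indicator_def elim!: eventually_mono\<close>)
    also have "(LINT x:T|lborel. f x) = integral T f"
      using fT by (rule set_borel_integral_eq_integral)
    finally have f_eq: "(\<integral>\<^sup>+x. ennreal (f x) * indicator S x \<partial>lborel) = ennreal (integral T f)" .
    have "ennreal (integral T f) \<le> (\<integral>\<^sup>+x. G x * indicator S x \<partial>lborel)"
    proof (rule ennreal_le_epsilon)
      fix e :: real assume "0 < e"
      obtain n where n: "integral T f - e \<le> (\<Sum>j\<in>{k * 2 ^ n ..< (k + 1) * 2 ^ n}. cell_essinf f n j / 2 ^ n)"
        using integral_le_cell_essinf_sum[OF nonneg riemann \<open>0 < e\<close>] by (auto simp: T_def)
      have "ennreal (integral T f) \<le> ennreal ((integral T f - e) + e)" by simp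
      also have "\<dots> \<le> ennreal (integral T f - e) + ennreal e"
      proof (cases "0 \<le> integral T f - e")
        case True
        then show ?thesis using \<open>0 < e\<close> by (subst ennreal_plus) auto
      next
        case False
        then have "ennreal (integral T f - e + e) \<le> ennreal e" by (intro ennreal_leI) simp
        also have "\<dots> \<le> ennreal (integral T f - e) + ennreal e" by simp
        finally show ?thesis .
      qed
      also have "ennreal (integral T f - e) \<le> (\<integral>\<^sup>+x\<in>S. ennreal (cell_essinf f n \<lfloor>x * 2 ^ n\<rfloor>) \<partial>lborel)"
        unfolding S_def nn_integral_cell_essinf[OF nonneg] by (rule ennreal_leI[OF n])
      also have "\<dots> \<le> (\<integral>\<^sup>+x. G x * indicator S x \<partial>lborel)"
        by (intro nn_integral_mono mult_right_mono) (auto simp: G_def intro: SUP_upper)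
      finally show "ennreal (integral T f) \<le> (\<integral>\<^sup>+x. G x * indicator S x \<partial>lborel) + ennreal e"
        by (simp add: add_right_mono)
    qed
    moreover have "(\<integral>\<^sup>+x. G x * indicator S x \<partial>lborel) < (\<integral>\<^sup>+x. ennreal (f x) * indicator S x \<partial>lborel)"
    proof (rule nn_integral_less)
      have le: "AE x in lborel. G x * indicator S x \<le> ennreal (f x) * indicator S x"
        using G_le by eventually_elim (auto simp: indicator_def)
      then show "AE x in lborel. G x * indicator S x \<le> ennreal (f x) * indicator S x" .
      from nn_integral_mono_AE[OF le] show "(\<integral>\<^sup>+x. G x * indicator S x \<partial>lborel) \<noteq> \<infinity>"
        unfolding f_eq by (auto simp: top_unique)
      show "\<not> (AE x in lborel. ennreal (f x) * indicator S x \<le> G x * indicator S x)"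
        by (rule not_AE)
    qed (simp_all add: S_def)
    ultimately show False using f_eq by simp
  qed
  then have "AE x in lborel. \<forall>k :: int. x \<in> {of_int k ..< of_int k + 1} \<longrightarrow> ennreal (f x) \<le> G x"
    unfolding AE_all_countable by (rule allI)
  then have "AE x in lborel. ennreal (f x) \<le> G x"
    by eventually_elim (use floor_correct in force)
  with G_le have "AE x in lborel. G x = ennreal (f x)"
    by eventually_elim (rule antisym)
  then show ?thesis by (simp add: G_def)
qed

text \<open>At almost every \<open>x\<close> the density is the sum of the increments over the cells that contain \<open>x\<close>;
  integrate this over \<open>A\<close>, one cell at a time.\<close>

lemma emeasure_density_cell_increments:
  assumes f: "integrable lborel f" and nonneg: "AE x in lborel. 0 \<le> f x"
    and riemann: "\<And>k :: int. f riemann_integrable_on {of_int k .. of_int k + 1}"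
    and A [measurable]: "A \<in> sets borel"
  shows "emeasure (density lborel (\<lambda>x. ennreal (f x))) A =
    (\<integral>\<^sup>+(i, k). ennreal (cell_increment f i k) * emeasure lborel (dyadic_cell i k \<inter> A) \<partial>count_space UNIV)"
proof -
  let ?c = "\<lambda>i k. ennreal (cell_increment f i k)"
  have [measurable]: "f \<in> borel_measurable borel" using f by simp
  have level: "(\<integral>\<^sup>+x. ?c i \<lfloor>x * 2 ^ i\<rfloor> * indicator A x \<partial>lborel)
    = (\<integral>\<^sup>+k. ?c i k * emeasure lborel (dyadic_cell i k \<inter> A) \<partial>count_space UNIV)" for i
  proof -
    have "?c i \<lfloor>x * 2 ^ i\<rfloor> * indicator A x
      = (\<integral>\<^sup>+k. ?c i k * indicator (dyadic_cell i k \<inter> A) x \<partial>count_space UNIV)" for x :: real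
      by (subst nn_integral_count_space'[of "{\<lfloor>x * 2 ^ i\<rfloor>}"]) (auto simp: dyadic_cell_def indicator_def)
    then have "(\<integral>\<^sup>+x. ?c i \<lfloor>x * 2 ^ i\<rfloor> * indicator A x \<partial>lborel)
      = (\<integral>\<^sup>+x. \<integral>\<^sup>+k. ?c i k * indicator (dyadic_cell i k \<inter> A) x \<partial>count_space UNIV \<partial>lborel)"
      by simp
    also have "\<dots> = (\<integral>\<^sup>+k. \<integral>\<^sup>+x. ?c i k * indicator (dyadic_cell i k \<inter> A) x \<partial>lborel \<partial>count_space UNIV)"
      by (rule nn_integral_count_space_nn_integral) auto
    also have "\<dots> = (\<integral>\<^sup>+k. ?c i k * emeasure lborel (dyadic_cell i k \<inter> A) \<partial>count_space UNIV)"
      by (intro nn_integral_cong nn_integral_cmult_indicator) auto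
    finally show ?thesis .
  qed
  have "emeasure (density lborel (\<lambda>x. ennreal (f x))) A = (\<integral>\<^sup>+x. ennreal (f x) * indicator A x \<partial>lborel)"
    by (intro emeasure_density) auto
  also have "\<dots> = (\<integral>\<^sup>+x. (\<Sum>i. ?c i \<lfloor>x * 2 ^ i\<rfloor> * indicator A x) \<partial>lborel)"
    using AE_SUP_cell_essinf[OF f nonneg riemann]
    by (intro nn_integral_cong_AE, eventually_elim)
       (simp add: ennreal_suminf_multc suminf_cell_increment[OF nonneg])
  also have "\<dots> = (\<Sum>i. \<integral>\<^sup>+x. ?c i \<lfloor>x * 2 ^ i\<rfloor> * indicator A x \<partial>lborel)"
    by (intro nn_integral_suminf) measurable
  also have "\<dots> = (\<integral>\<^sup>+i. \<integral>\<^sup>+k. ?c i k * emeasure lborel (dyadic_cell i k \<inter> A) \<partial>count_space UNIV \<partial>count_space UNIV)"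
    by (simp add: level nn_integral_count_space_nat)
  also have "\<dots> = (\<integral>\<^sup>+(i, k). ?c i k * emeasure lborel (dyadic_cell i k \<inter> A) \<partial>count_space UNIV)"
    by (subst nn_integral_fst_count_space[symmetric]) simp
  finally show ?thesis .
qed

section \<open>Riemann integrable densities are mixtures\<close>

definition dyadic_ends :: "nat \<times> int \<Rightarrow> real \<times> real" where
  "dyadic_ends = (\<lambda>(i, k). (of_int k / 2 ^ i, (of_int k + 1) / 2 ^ i))"

lemma dyadic_ends_in_dyadic_intervals: "dyadic_ends ik \<in> dyadic_intervals"
proof -
  obtain i k where ik: "ik = (i, k)" by fastforce
  have "dyadic_ends ik = (of_int k * 2 powi (- int i), (of_int k + 1) * 2 powi (- int i))"
    by (simp add: ik dyadic_ends_def power_int_minus divide_inverse)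
  then show ?thesis unfolding dyadic_intervals_def by blast
qed

lemma inj_dyadic_ends: "inj dyadic_ends"
proof (rule injI)
  fix p q :: "nat \<times> int" assume eq: "dyadic_ends p = dyadic_ends q"
  obtain i k j l where pq: "p = (i, k)" "q = (j, l)" by fastforce
  have *: "of_int k / 2 ^ i = (of_int l / 2 ^ j :: real)"
    "(of_int k + 1) / 2 ^ i = ((of_int l + 1) / 2 ^ j :: real)"
    using eq by (simp_all add: pq dyadic_ends_def)
  then have "1 / 2 ^ i = (1 / 2 ^ j :: real)" by (simp add: add_divide_distrib)
  then have "i = j" by simp
  with *(1) show "p = q" by (simp add: pq)
qed

text \<open>The cell and the open interval differ by the left endpoint, a null set, and the
  weight \<open>c / 2 ^ i\<close> compensates the factor \<open>2 ^ i\<close> in the uniform density.\<close>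

lemma emeasure_unif_dyadic_ends:
  assumes A [measurable]: "A \<in> sets borel" and "0 \<le> c"
  shows "ennreal (c / 2 ^ i) * emeasure (case dyadic_ends (i, k) of (p, q) \<Rightarrow> unif p q) A
    = ennreal c * emeasure lborel (dyadic_cell i k \<inter> A)"
proof -
  define p q where "p = of_int k / (2 ^ i :: real)" and "q = (of_int k + 1) / (2 ^ i :: real)"
  have len: "q - p = 1 / 2 ^ i" by (simp add: p_def q_def add_divide_distrib)
  then have "0 < q - p" by simp
  then have pq: "p < q" by simp
  have "emeasure lborel ({p<..<q} \<inter> A) = emeasure lborel (dyadic_cell i k \<inter> A)"
  proof (rule emeasure_eq_AE)
    show "AE x in lborel. x \<in> {p<..<q} \<inter> A \<longleftrightarrow> x \<in> dyadic_cell i k \<inter> A"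
      using AE_lborel_singleton[of p]
      by eventually_elim (auto simp: dyadic_cell_eq p_def[symmetric] q_def[symmetric])
  qed simp_all
  then have "ennreal (c / 2 ^ i) * emeasure (unif p q) A
    = ennreal c * ennreal (q - p) * (emeasure lborel (dyadic_cell i k \<inter> A) / ennreal (q - p))"
    using \<open>0 \<le> c\<close> by (simp add: emeasure_unif[OF pq A] len ennreal_mult[symmetric])
  also have "\<dots> = ennreal c * (emeasure lborel (dyadic_cell i k \<inter> A) * ennreal (q - p) / ennreal (q - p))"
    by (simp only: ennreal_times_divide mult.assoc mult.commute[of "ennreal (q - p)"])
  also have "emeasure lborel (dyadic_cell i k \<inter> A) * ennreal (q - p) / ennreal (q - p)
    = emeasure lborel (dyadic_cell i k \<inter> A)"
    by (rule mult_divide_eq_ennreal) (use \<open>0 < q - p\<close> in auto)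
  finally show ?thesis by (simp add: dyadic_ends_def p_def q_def)
qed

lemma riemann_density_in_Mix_dyadic:
  assumes \<mu>: "prob_space \<mu>" "sets \<mu> = sets borel" and f: "lebesgue_density \<mu> f"
    and riemann: "\<And>k :: int. f riemann_integrable_on {of_int k .. of_int k + 1}"
  shows "\<mu> \<in> Mix dyadic_intervals (\<lambda>(p, q). unif p q)"
proof -
  have [measurable]: "f \<in> borel_measurable borel" and nonneg: "AE x in lborel. 0 \<le> f x"
    and dens: "\<mu> = density lborel (\<lambda>x. ennreal (f x))"
    using f by (simp_all add: lebesgue_density_def)
  have "emeasure \<mu> UNIV = 1"
    using prob_space.emeasure_space_1[OF \<mu>(1)] sets_eq_imp_space_eq[OF \<mu>(2)] by simp
  then have "(\<integral>\<^sup>+x. ennreal (f x) \<partial>lborel) = ennreal 1"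
    by (simp add: dens emeasure_density)
  then have int: "integrable lborel f"
    using nonneg by (intro integrableI_nn_integral_finite) auto
  \<comment> \<open>The increment is a height; the weight of its component is the area over the cell.\<close>
  define w where "w j = (if j \<in> range dyadic_ends
    then case inv dyadic_ends j of (i, k) \<Rightarrow> cell_increment f i k / 2 ^ i else 0)" for j
  show ?thesis
  proof (rule MixI_nn_integral(1)[OF \<mu>])
    fix A :: "real set" assume A: "A \<in> sets borel"
    let ?g = "\<lambda>j. ennreal (w j) * emeasure (case j of (p, q) \<Rightarrow> unif p q) A"
    have "(\<integral>\<^sup>+j. ?g j \<partial>count_space dyadic_intervals) = (\<integral>\<^sup>+j. ?g j \<partial>count_space (range dyadic_ends))"
      by (rule nn_integral_count_space_eq) (use dyadic_ends_in_dyadic_intervals in \<open>auto simp: w_def\<close>)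
    also have "\<dots> = (\<integral>\<^sup>+ik. ?g (dyadic_ends ik) \<partial>count_space UNIV)"
      by (rule nn_integral_bij_count_space[symmetric]) (rule inj_on_imp_bij_betw[OF inj_dyadic_ends])
    also have "\<dots> = (\<integral>\<^sup>+(i, k). ennreal (cell_increment f i k) * emeasure lborel (dyadic_cell i k \<inter> A) \<partial>count_space UNIV)"
    proof (rule nn_integral_cong)
      fix ik :: "nat \<times> int"
      obtain i k where ik: "ik = (i, k)" by fastforce
      have "w (dyadic_ends ik) = cell_increment f i k / 2 ^ i"
        by (simp add: w_def ik inv_f_f[OF inj_dyadic_ends])
      then show "?g (dyadic_ends ik) =
          (case ik of (i, k) \<Rightarrow> ennreal (cell_increment f i k) * emeasure lborel (dyadic_cell i k \<inter> A))"
        using emeasure_unif_dyadic_ends[OF A cell_increment_nonneg[OF nonneg]] by (simp add: ik)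
    qed
    finally show "emeasure \<mu> A = (\<integral>\<^sup>+j. ?g j \<partial>count_space dyadic_intervals)"
      using emeasure_density_cell_increments[OF int nonneg riemann A] dens by simp
  next
    show "0 \<le> w j" for j
      by (auto simp: w_def cell_increment_nonneg[OF nonneg] split: prod.split)
  qed (auto simp: prob_space_unif dyadic_intervals_less)
qed

section \<open>Dyadic mixtures of uniform distributions\<close>

theorem theorem11:
  "(\<nexists>\<mu>. extreme_element (Mix dyadic_intervals (\<lambda>(p, q). unif p q)) \<mu>) \<and>
   (\<forall>\<mu> :: real measure.
      prob_space \<mu> \<and> sets \<mu> = sets borel \<and> absolutely_continuous lborel \<mu> \<and>
      (\<exists>f. lebesgue_density \<mu> f \<and> (\<forall>a b. a \<le> b \<longrightarrow> f riemann_integrable_on {a..b}))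
      \<longrightarrow> \<mu> \<in> Mix dyadic_intervals (\<lambda>(p, q). unif p q)) \<and>
   (\<exists>\<mu> :: real measure.
      prob_space \<mu> \<and> sets \<mu> = sets borel \<and> absolutely_continuous lborel \<mu> \<and>
      \<mu> \<notin> Mix dyadic_intervals (\<lambda>(p, q). unif p q))"
proof (intro conjI allI impI)
  show "\<nexists>\<mu>. extreme_element (Mix dyadic_intervals (\<lambda>(p, q). unif p q)) \<mu>"
    using Mix_dyadic_no_extreme by blast
next
  fix \<mu> :: "real measure"
  assume *: "prob_space \<mu> \<and> sets \<mu> = sets borel \<and> absolutely_continuous lborel \<mu> \<and>
      (\<exists>f. lebesgue_density \<mu> f \<and> (\<forall>a b. a \<le> b \<longrightarrow> f riemann_integrable_on {a..b}))"
  then obtain f where "lebesgue_density \<mu> f" "\<And>a b. a \<le> b \<Longrightarrow> f riemann_integrable_on {a..b}"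
    by blast
  with * show "\<mu> \<in> Mix dyadic_intervals (\<lambda>(p, q). unif p q)"
    by (intro riemann_density_in_Mix_dyadic[of \<mu> f]) auto
next
  show "\<exists>\<mu> :: real measure. prob_space \<mu> \<and> sets \<mu> = sets borel \<and> absolutely_continuous lborel \<mu> \<and>
      \<mu> \<notin> Mix dyadic_intervals (\<lambda>(p, q). unif p q)"
    by (rule ex_absolutely_continuous_not_Mix)
qed

end
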